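(* Let $w\in S_n$ be a fireworks permutation and let $P\in\mathrm{PD}(w)$ be a pipe dream with $\mathrm{wt}(P)<\mathrm{wt}(\overline{D(w)})$. For any $a$ with $\mathrm{wt}(P)_a<\mathrm{wt}(\overline{D(w)})_a$, there exists a pipe dream $Q\in\mathrm{PD}(w)$ satisfying: (i) $\mathrm{wt}(Q)_b=\mathrm{wt}(P)_b$ for all $b<a$; (ii) $\mathrm{wt}(Q)_a=\mathrm{wt}(P)_a+1$; (iii) $\mathrm{wt}(Q)_b\le\mathrm{wt}(P)_b$ for all $b>a$.
   Context: Notation: $[n]=\{1,\dots,n\}$; permutations are in one-line notation. For integer vectors, $u\le v$ is the componentwise order, and $u<v$ means $u\le v$ and $u\ne v$. Fireworks: $w\in S_n$ is fireworks if the initial terms of its decreasing runs (maximal decreasing strings of consecutive entries $w(a)>w(a+1)>\dots>w(b)$) are increasing from left to right. Equivalently, there are no $i<j$ with $w(j)<w(j+1)<w(i)$. Pipe dreams: a pipe dream (of size $n$) is a filling of the staircase grid $\{(i,j)\in[n]\times[n]:i+j\le n\}$ ($i$ = row from the top, $j$ = column from the left) with cross tiles and bump tiles; half-bump tiles (connecting top edge to left edge) are placed on the antidiagonal $i+j=n+1$. In a bump tile, the pipe entering from the top edge exits from the left edge and the pipe entering from the right edge exits from the bottom edge. In a cross tile, the pipe entering from the top exits from the bottom and the pipe entering from the right exits from the left, except that if the two pipes have already crossed (earlier along their way from the top edge of the grid to the left edge; equivalently when processing rows from top to bottom and each row from right to left), then the cross tile is redundant and is treated as a bump tile for the purpose of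 tracing pipes. The $n$ pipes are labeled $1,\dots,n$ along the top edge (pipe $i$ enters in column $i$). Tracing them in this way, the permutation $\partial(P)\in S_n$ associated to $P$ has $(\partial(P))(r)$ equal to the label of the pipe exiting the left edge in row $r$. $\mathrm{PD}(w)$ is the set of pipe dreams $P$ with $\partial(P)=w$. The weight $\mathrm{wt}(P)\in\mathbb Z_{\ge0}^n$ records in its $i$-th component the number of cross tiles (redundant or not) in row $i$. Rothe diagram: $D(w)=\{(i,j)\in[n]\times[n]:i<w^{-1}(j)\text{ and }j<w(i)\}$. For a diagram $D\subseteq[n]\times[m]$, $\overline D=\{(i,j)\in[n]\times[m]:(i',j)\in D\text{ for some }i'\ge i\}$, and $\mathrm{wt}(D)\in\mathbb Z_{\ge0}^n$ is the vector whose $i$-th component is the number of boxes of $D$ in row $i$. *)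

theory Defs
  imports "HOL-Combinatorics.Permutations"
begin

text \<open>
  A permutation in \<open>S\<^sub>n\<close> is a function \<open>w :: nat \<Rightarrow> nat\<close> with \<open>w permutes {1..n}\<close>; its one-line
  notation is \<open>w 1, \<dots>, w n\<close>. Boxes are pairs (row from the top, column from the left), both
  counted from 1.
\<close>

type_synonym diagram = "(nat \<times> nat) set"

definition decreasing_run :: "nat \<Rightarrow> (nat \<Rightarrow> nat) \<Rightarrow> nat \<Rightarrow> nat \<Rightarrow> bool" where
  "decreasing_run n w a b \<longleftrightarrow>
     1 \<le> a \<and> a \<le> b \<and> b \<le> n \<and> strict_antimono_on {a..b} w \<and>
     (\<forall>a' b'. 1 \<le> a' \<and> a' \<le> a \<and> b \<le> b' \<and> b' \<le> n \<and> strict_antimono_on {a'..b'} w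
        \<longrightarrow> a' = a \<and> b' = b)"

definition fireworks :: "nat \<Rightarrow> (nat \<Rightarrow> nat) \<Rightarrow> bool" where
  "fireworks n w \<longleftrightarrow>
     (\<forall>a b a' b'. decreasing_run n w a b \<and> decreasing_run n w a' b' \<and> a < a' \<longrightarrow> w a < w a')"

text \<open>
  A pipe dream of size \<open>n\<close> is represented by the set of positions of its cross tiles; all other
  boxes of the staircase carry bump tiles.
\<close>

definition pipe_dreams :: "nat \<Rightarrow> diagram set" where
  "pipe_dreams n = Pow {(i, j). 1 \<le> i \<and> 1 \<le> j \<and> i + j \<le> n}"

text \<open>
  A state \<open>(v, h, X)\<close> of the tracing procedure consists of the label \<open>v j\<close> of the pipe on the
  horizontal edge currently reached in each column \<open>j\<close>, the label \<open>h\<close> of the pipe on the vertical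
  edge currently reached in the row being processed, and the set \<open>X\<close> of unordered pairs of pipes
  that have crossed so far. In \<open>trace_tile\<close>, \<open>v j\<close> enters box \<open>(i, j)\<close> from the top and \<open>h\<close> enters
  it from the right; in the resulting state, \<open>v j\<close> leaves from the bottom and \<open>h\<close> from the left.
  The second alternative covers bump tiles and redundant cross tiles.
\<close>

type_synonym trace_state = "(nat \<Rightarrow> nat) \<times> nat \<times> nat set set"

definition trace_tile :: "diagram \<Rightarrow> nat \<Rightarrow> nat \<Rightarrow> trace_state \<Rightarrow> trace_state" where
  "trace_tile P i j = (\<lambda>(v, h, X).
     if (i, j) \<in> P \<and> {v j, h} \<notin> X
     then (v, h, insert {v j, h} X)
     else (v(j := h), v j, X))"

text \<open>
  Row \<open>i\<close> starts with the half-bump tile in column \<open>n + 1 - i\<close>, which sends the pipe entering from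
  its top to its left, and continues with the columns \<open>n - i, \<dots>, 1\<close> in this order.
\<close>

definition trace_row :: "nat \<Rightarrow> diagram \<Rightarrow> nat \<Rightarrow> trace_state \<Rightarrow> trace_state" where
  "trace_row n P i = (\<lambda>(v, h, X).
     fold (trace_tile P i) (rev [1..<n + 1 - i]) (v, v (n + 1 - i), X))"

text \<open>The value 0 of the horizontal component in the initial state is never used.\<close>

primrec trace_rows :: "nat \<Rightarrow> diagram \<Rightarrow> nat \<Rightarrow> trace_state" where
  "trace_rows n P 0 = ((\<lambda>j. j), 0, {})"
| "trace_rows n P (Suc i) = trace_row n P (Suc i) (trace_rows n P i)"

text \<open>
  The permutation \<open>\<partial>(P)\<close>, extended by the identity outside \<open>{1..n}\<close> as required by \<open>permutes\<close>.
\<close>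

definition pd_perm :: "nat \<Rightarrow> diagram \<Rightarrow> nat \<Rightarrow> nat" where
  "pd_perm n P r = (if r \<in> {1..n} then fst (snd (trace_rows n P r)) else r)"

definition PD :: "nat \<Rightarrow> (nat \<Rightarrow> nat) \<Rightarrow> diagram set" where
  "PD n w = {P \<in> pipe_dreams n. pd_perm n P = w}"

definition rothe_diagram :: "nat \<Rightarrow> (nat \<Rightarrow> nat) \<Rightarrow> diagram" where
  "rothe_diagram n w = {(i, j) \<in> {1..n} \<times> {1..n}. i < inv w j \<and> j < w i}"

text \<open>
  The diagram usually denoted by \<open>D\<close> with a bar, for \<open>D \<subseteq> {1..n} \<times> {1..m}\<close>.
\<close>

definition upward_closure :: "nat \<Rightarrow> nat \<Rightarrow> diagram \<Rightarrow> diagram" where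
  "upward_closure n m D = {(i, j) \<in> {1..n} \<times> {1..m}. \<exists>i'\<ge>i. (i', j) \<in> D}"

text \<open>
  The weight of a diagram, and also of a pipe dream (which is the set of its cross tiles, redundant
  ones included). For diagrams with all rows in \<open>{1..n}\<close> the weight vanishes outside \<open>{1..n}\<close>, so
  that the pointwise orders \<open>\<le>\<close> and \<open><\<close> of the function type \<open>nat \<Rightarrow> nat\<close> are the componentwise
  orders of vectors of length \<open>n\<close>.
\<close>

definition wt :: "diagram \<Rightarrow> nat \<Rightarrow> nat" where
  "wt D i = card {j. (i, j) \<in> D}"

end

theory Submission
  imports Defs
begin

text \<open>
  Record the pipes along the lattice path that separates the boxes already traced from the others:
  this is a permutation \<open>x\<close> in one-line notation, and a cross in box \<open>(i, j)\<close> exchanges the entries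
  \<open>x k < x (k + 1)\<close> at \<open>k = i + j - 1\<close>, or does nothing if they are already inverted. So
  a pipe dream is a word in the 0-Hecke monoid, the pairs of pipes that have crossed are the
  inversions of \<open>x\<close>, and inversions are never lost. The proof has three ingredients.

  Weight. In a fireworks permutation a column \<open>j\<close> of the diagram closure reaches row \<open>a\<close> only if \<open>j\<close>
  is the lower entry of a descent of \<open>w\<close> at a position \<open>\<ge> a\<close>. Hence the hypothesis on row \<open>a\<close> says
  that row \<open>a\<close> of \<open>P\<close> has fewer crosses than \<open>w\<close> has descents at positions \<open>\<ge> a\<close>
  (\<open>wt_closure_le_descents\<close>).

  Forcing. Enlarge the set of crosses of row \<open>a\<close> in any way such that the enlarged row creates only
  inversions of \<open>w\<close>. Then, deleting suitable crosses below row \<open>a\<close>, one obtains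
  again a pipe dream of \<open>w\<close> (\<open>force_crosses\<close>). The reason is an exchange property: if two neighbouring
  pipes must cross eventually, one can let them cross at once and delete some later crosses
  (\<open>exchange\<close>).

  Counting. It remains to find one bump of row \<open>a\<close> whose replacement by a cross creates only
  inversions of \<open>w\<close> (\<open>insertable_position\<close>). The bumps cut row \<open>a\<close> into blocks of consecutive
  crosses, and each block sends out its maximal pipe. If the bump between two neighbouring blocks
  cannot be replaced, then the maximal pipe of the left block occurs in \<open>w\<close> before that of the right
  block, and \<open>w\<close> has an ascent between them. If no bump can be replaced, \<open>w\<close> therefore has
  at least as many ascents at positions \<open>\<ge> a\<close> as row \<open>a\<close> has bumps, so at most as many descents as
  row \<open>a\<close> has crosses, against the first ingredient.
\<close>

section \<open>Inversions\<close>

text \<open>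
  Inversions are pairs of values (labels of pipes), not of positions: a pair of pipes keeps its
  meaning while the pipes move.
\<close>

definition inversions :: "(nat \<Rightarrow> nat) \<Rightarrow> (nat \<times> nat) set" where
  "inversions x = {(x i, x j) | i j. i < j \<and> x j < x i}"

lemma inversionsI: "i < j \<Longrightarrow> x j < x i \<Longrightarrow> (x i, x j) \<in> inversions x"
  by (auto simp: inversions_def)

lemma inversionsE:
  assumes "r \<in> inversions x"
  obtains i j where "r = (x i, x j)" "i < j" "x j < x i"
  using assms by (auto simp: inversions_def)

lemma inversions_id: "inversions (\<lambda>k. k) = {}"
  by (auto simp: inversions_def)

lemma inversions_iff:
  assumes "bij w"
  shows "(p, q) \<in> inversions w \<longleftrightarrow> q < p \<and> inv w p < inv w q"
proof -
  have "w (inv w p) = p" "w (inv w q) = q" "\<And>i. inv w (w i) = i"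
    using assms by (auto simp: bij_is_surj surj_f_inv_f bij_is_inj inv_f_f)
  then show ?thesis
    unfolding inversions_def by (auto; metis)
qed

text \<open>
  Exchanging two neighbouring entries changes the relative order of this one pair only.
\<close>

lemma inversions_swap:
  assumes "x k < x (Suc k)"
  shows "inversions (x \<circ> transpose k (Suc k)) = insert (x (Suc k), x k) (inversions x)"
proof -
  let ?t = "transpose k (Suc k)"
  have mono: "?t i < ?t j" if "i < j" "(i, j) \<noteq> (k, Suc k)" for i j
    using that by (auto simp: transpose_def)
  have new: "(x (?t i), x (?t j)) \<in> insert (x (Suc k), x k) (inversions x)"
    if "i < j" "x (?t j) < x (?t i)" for i j
  proof (cases "(i, j) = (k, Suc k)")
    case True
    then show ?thesis by simp
  next
    case False
    then show ?thesis using mono[OF that(1) False] that(2) by (auto intro: inversionsI)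
  qed
  have old: "(x i, x j) \<in> inversions (x \<circ> ?t)" if "i < j" "x j < x i" for i j
  proof -
    have "(i, j) \<noteq> (k, Suc k)" using that assms by auto
    then have "?t i < ?t j" using mono that by blast
    from inversionsI[of "?t i" "?t j" "x \<circ> ?t", OF this] show ?thesis using that by simp
  qed
  have swapped: "(x (Suc k), x k) \<in> inversions (x \<circ> ?t)"
    using inversionsI[of k "Suc k" "x \<circ> ?t"] assms by simp
  show ?thesis
  proof (intro equalityI subsetI)
    fix r
    assume "r \<in> inversions (x \<circ> ?t)"
    then show "r \<in> insert (x (Suc k), x k) (inversions x)"
      by (rule inversionsE) (simp only: comp_apply new)
  next
    fix r
    assume "r \<in> insert (x (Suc k), x k) (inversions x)"
    then show "r \<in> inversions (x \<circ> ?t)"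
    proof
      assume "r = (x (Suc k), x k)"
      then show ?thesis using swapped by (simp only:)
    next
      assume "r \<in> inversions x"
      then show ?thesis by (rule inversionsE) (simp only: old)
    qed
  qed
qed

text \<open>
  The right action of a generator of the 0-Hecke monoid (Demazure product).
\<close>

definition hecke_step :: "nat \<Rightarrow> (nat \<Rightarrow> nat) \<Rightarrow> nat \<Rightarrow> nat" where
  "hecke_step k x = (if x k < x (Suc k) then x \<circ> transpose k (Suc k) else x)"

lemma inversions_hecke_step:
  "inversions (hecke_step k x) =
     inversions x \<union> (if x k < x (Suc k) then {(x (Suc k), x k)} else {})"
  by (simp add: hecke_step_def inversions_swap)

lemma hecke_step_other: "l \<noteq> k \<Longrightarrow> l \<noteq> Suc k \<Longrightarrow> hecke_step k x l = x l"
  by (simp add: hecke_step_def)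

lemma hecke_step_at: "hecke_step k x k = max (x k) (x (Suc k))"
  by (simp add: hecke_step_def)

lemma bij_hecke_step: "bij x \<Longrightarrow> bij (hecke_step k x)"
  by (auto simp: hecke_step_def intro: bij_comp)

section \<open>Reading boxes\<close>

text \<open>
  The pipe entering box \<open>(i, j)\<close> from the top is preceded, on the path of the pipes, by the \<open>i - 1\<close>
  pipes that have left the grid in the rows above and by the pipes in the columns \<open>1, \<dots>, j - 1\<close>; the
  pipe entering from the right comes next.
\<close>

definition box_pos :: "nat \<times> nat \<Rightarrow> nat" where
  "box_pos b = fst b + snd b - 1"

definition read_box :: "diagram \<Rightarrow> nat \<times> nat \<Rightarrow> (nat \<Rightarrow> nat) \<Rightarrow> nat \<Rightarrow> nat" where
  "read_box P b x = (if b \<in> P then hecke_step (box_pos b) x else x)"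

abbreviation read_boxes :: "diagram \<Rightarrow> (nat \<times> nat) list \<Rightarrow> (nat \<Rightarrow> nat) \<Rightarrow> nat \<Rightarrow> nat" where
  "read_boxes P \<equiv> fold (read_box P)"

lemma read_boxes_cong:
  assumes "\<And>b. b \<in> set bs \<Longrightarrow> b \<in> P \<longleftrightarrow> b \<in> Q"
  shows "read_boxes P bs x = read_boxes Q bs x"
  by (rule fold_cong) (use assms in \<open>auto simp: read_box_def fun_eq_iff\<close>)

lemma inversions_read_boxes_mono: "inversions x \<subseteq> inversions (read_boxes P bs x)"
proof (induction bs arbitrary: x)
  case (Cons b bs)
  have "inversions x \<subseteq> inversions (read_box P b x)"
    by (auto simp: read_box_def inversions_hecke_step)
  then show ?case using Cons.IH[of "read_box P b x"] by simp
qed simp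

lemma bij_read_boxes: "bij x \<Longrightarrow> bij (read_boxes P bs x)"
  by (induction bs arbitrary: x) (auto simp: read_box_def bij_hecke_step)

lemma read_boxes_other:
  assumes "\<And>b. b \<in> set bs \<Longrightarrow> l \<noteq> box_pos b \<and> l \<noteq> Suc (box_pos b)"
  shows "read_boxes P bs x l = x l"
  using assms by (induction bs arbitrary: x) (auto simp: read_box_def hecke_step_other)

section \<open>The exchange\<close>

text \<open>
  Run the same word on \<open>x\<close> and on \<open>x\<close> with the pipes \<open>p < q\<close> exchanged, deleting in the second run
  every cross that is redundant in the first one, and the cross at which \<open>p\<close> and \<open>q\<close> meet in the first
  one; from then on the two runs agree. Until then each remaining cross is effective in both runs: this
  could fail only if \<open>p\<close> or \<open>q\<close> crossed a pipe with label between \<open>p\<close> and \<open>q\<close> that stands between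
  them. No such pipe exists, as a pipe can get between them only by crossing \<open>p\<close>
  from the left, so with a label below \<open>p\<close>, or \<open>q\<close> from the right, so with a label above \<open>q\<close>. The
  last assumption says that \<open>p\<close> and \<open>q\<close> do meet.
\<close>

lemma transpose_read_boxes:
  assumes "bij x" and "p < q" and "distinct bs"
    and "inv x p < inv x q"
    and "\<And>l. inv x p < l \<Longrightarrow> l < inv x q \<Longrightarrow> x l < p \<or> q < x l"
    and "(q, p) \<in> inversions (read_boxes P bs x)"
  shows "\<exists>P' \<subseteq> P. P - P' \<subseteq> set bs \<and>
           read_boxes P' bs (transpose p q \<circ> x) = read_boxes P bs x"
  using assms
proof (induction bs arbitrary: x)
  case Nil
  then show ?case by (simp add: inversions_iff)
next
  case (Cons b bs)
  let ?t = "transpose p q"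
  define k where "k = box_pos b"
  have inj: "inj x" and sur: "\<And>y. x (inv x y) = y" and isx: "\<And>i. inv x (x i) = i"
    using \<open>bij x\<close> by (auto simp: bij_is_inj bij_is_surj surj_f_inv_f inv_f_f)
  \<comment> \<open>As \<open>bs\<close> is distinct, deleting the cross \<open>b\<close> does not affect the rest of the word.\<close>
  have drop: "\<exists>P' \<subseteq> P. P - P' \<subseteq> set (b # bs) \<and> read_boxes P' (b # bs) y = u"
    if "\<exists>P' \<subseteq> P. P - P' \<subseteq> set bs \<and> read_boxes P' bs y = u" for y u
  proof -
    obtain P' where P': "P' \<subseteq> P" "P - P' \<subseteq> set bs" "read_boxes P' bs y = u"
      using \<open>\<exists>P' \<subseteq> P. _\<close> by blast
    have "read_boxes (P' - {b}) bs y = read_boxes P' bs y"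
      using Cons.prems(3) by (intro read_boxes_cong) auto
    then have "read_boxes (P' - {b}) (b # bs) y = u" using P' by (simp add: read_box_def)
    then show ?thesis using P' by (intro exI[of _ "P' - {b}"]) auto
  qed
  show ?case
  proof (cases "b \<in> P \<and> x k < x (Suc k)")
    case False
    then have "read_box P b x = x"
      by (auto simp: read_box_def k_def hecke_step_def)
    then show ?thesis using Cons by (intro drop) auto
  next
    case True
    define y where "y = x \<circ> transpose k (Suc k)"
    have rb: "read_box P b x = y"
      using True by (auto simp: read_box_def k_def hecke_step_def y_def)
    show ?thesis
    proof (cases "x k = p \<and> x (Suc k) = q")
      case True
      have "y = ?t \<circ> x"
      proof
        fix l
        show "y l = (?t \<circ> x) l"
          using True inj by (auto simp: y_def transpose_def inj_eq)
      qed
      then have "read_boxes P bs (?t \<circ> x) = read_boxes P (b # bs) x" using rb by simp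
      then show ?thesis by (intro drop) blast
    next
      case False
      define i where "i = inv x p"
      define j where "j = inv x q"
      have xi: "x i = p" and xj: "x j = q" by (simp_all add: i_def j_def sur)
      have ij: "i < j" using Cons.prems(4) by (simp add: i_def j_def)
      have betw: "x l < p \<or> q < x l" if "i < l" "l < j" for l
        using Cons.prems(5) that by (simp add: i_def j_def)
      have nij: "\<not> (i = k \<and> j = Suc k)" using False xi xj by auto
      let ?s = "transpose k (Suc k)"
      have "bij y" using \<open>bij x\<close> by (auto simp: y_def intro: bij_comp)
      have iy: "inv y p = ?s i" "inv y q = ?s j"
        using \<open>bij y\<close> xi xj by (auto simp: y_def bij_is_inj intro!: inv_f_eq)
      have less: "?s i < ?s j" using ij nij by (auto simp: transpose_def)
      have xk: "x k < x (Suc k)" using True by simp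
      \<comment> \<open>The two exceptional cases are those in which a pipe has just crossed \<open>p\<close> or \<open>q\<close>.\<close>
      have betw': "y l < p \<or> q < y l" if l: "?s i < l" "l < ?s j" for l
      proof -
        have "i < ?s l \<and> ?s l < j \<or> ?s l = k \<and> Suc k = i \<or> ?s l = Suc k \<and> k = j"
          using l ij nij unfolding transpose_def by presburger
        then consider "i < ?s l" "?s l < j" | "?s l = k" "Suc k = i" | "?s l = Suc k" "k = j"
          by blast
        then show ?thesis
        proof cases
          case 1
          then show ?thesis using betw by (simp add: y_def)
        next
          case 2
          then show ?thesis using xk xi by (simp add: y_def)
        next
          case 3
          then show ?thesis using xk xj by (simp add: y_def)
        qed
      qed
      \<comment> \<open>The cross is effective also after the exchange of \<open>p\<close> and \<open>q\<close>.\<close>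
      have tlt: "?t (x k) < ?t (x (Suc k))"
      proof -
        consider "k = i" "Suc k \<noteq> j" | "k = j" | "Suc k = i" | "Suc k = j" "k \<noteq> i"
          | "k \<noteq> i" "k \<noteq> j" "Suc k \<noteq> i" "Suc k \<noteq> j"
          using nij by blast
        then show ?thesis
        proof cases
          case 1
          then have "Suc k < j" using ij by auto
          then have "q < x (Suc k)" using betw[of "Suc k"] 1 xk xi by auto
          then show ?thesis using 1 xi \<open>p < q\<close> by (auto simp: transpose_def)
        next
          case 2
          then show ?thesis using xk xj \<open>p < q\<close> by (auto simp: transpose_def)
        next
          case 3
          then show ?thesis using xk xi \<open>p < q\<close> by (auto simp: transpose_def)
        next
          case 4
          then have "i < k" using ij by auto
          then have "x k < p" using betw[of k] 4 xk xj by auto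
          then show ?thesis using 4 xj \<open>p < q\<close> by (auto simp: transpose_def)
        next
          case 5
          have "x k \<noteq> p" "x k \<noteq> q" "x (Suc k) \<noteq> p" "x (Suc k) \<noteq> q"
            using 5 xi xj inj by (metis inj_eq)+
          then show ?thesis using xk by simp
        qed
      qed
      have "\<exists>P' \<subseteq> P. P - P' \<subseteq> set bs \<and> read_boxes P' bs (?t \<circ> y) = read_boxes P bs y"
        using Cons.prems rb \<open>bij y\<close> less betw' by (intro Cons.IH) (auto simp: iy)
      then obtain P' where P': "P' \<subseteq> P" "P - P' \<subseteq> set bs"
          "read_boxes P' bs (?t \<circ> y) = read_boxes P bs y" by blast
      have "b \<in> P'" using P' True Cons.prems(3) by auto
      then have "read_box P' b (?t \<circ> x) = ?t \<circ> y"
        using tlt by (auto simp: read_box_def hecke_step_def k_def y_def comp_assoc)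
      moreover have "read_boxes P' (b # bs) (?t \<circ> x) =
          read_boxes P' bs (read_box P' b (?t \<circ> x))"
        by simp
      ultimately have "read_boxes P' (b # bs) (?t \<circ> x) = read_boxes P (b # bs) x"
        using P'(3) rb by (metis fold_simps(2))
      moreover have "P - P' \<subseteq> set (b # bs)" using P'(2) by auto
      ultimately show ?thesis using P'(1) by blast
    qed
  qed
qed

text \<open>
  Neighbouring pipes have no pipe between them, so the invariant of \<open>transpose_read_boxes\<close> holds at
  the start.
\<close>

lemma exchange:
  assumes "bij x" and "x k < x (Suc k)" and "distinct bs"
    and "(x (Suc k), x k) \<in> inversions (read_boxes P bs x)"
  shows "\<exists>P' \<subseteq> P. P - P' \<subseteq> set bs \<and>
           read_boxes P' bs (x \<circ> transpose k (Suc k)) = read_boxes P bs x"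
proof -
  have inj: "inj x" using assms(1) by (rule bij_is_inj)
  have eq: "x \<circ> transpose k (Suc k) = transpose (x k) (x (Suc k)) \<circ> x"
    using inj by (auto simp: transpose_def inj_eq fun_eq_iff)
  show ?thesis unfolding eq
    by (rule transpose_read_boxes) (use assms inj in \<open>auto simp: inv_f_f\<close>)
qed

text \<open>
  The crosses of \<open>A\<close> are inserted one by one, in reading order. A new cross either meets two pipes
  that have already crossed, and is harmless, or it inverts a pair that the word inverts later
  anyway, and \<open>exchange\<close> compensates for it. This may delete crosses that are still to be read in
  \<open>rs\<close>; they belong to \<open>A\<close> and are put back when their turn comes.
\<close>

lemma force_crosses:
  assumes "bij x" and "distinct (rs @ ls)"
    and "P \<inter> set rs \<subseteq> A"
    and "read_boxes P (rs @ ls) x = u"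
    and "inversions (read_boxes A rs x) \<subseteq> inversions u"
  shows "\<exists>Q. (\<forall>b. b \<notin> set (rs @ ls) \<longrightarrow> (b \<in> Q \<longleftrightarrow> b \<in> P)) \<and>
           (\<forall>b \<in> set rs. b \<in> Q \<longleftrightarrow> b \<in> A) \<and> Q \<inter> set ls \<subseteq> P \<and>
           read_boxes Q (rs @ ls) x = u"
  using assms
proof (induction rs arbitrary: x P)
  case Nil
  then show ?case by (intro exI[of _ P]) auto
next
  case (Cons b rs)
  define y where "y = read_box A b x"
  have "bij y" using Cons.prems(1) by (auto simp: y_def read_box_def bij_hecke_step)
  have sub: "inversions (read_boxes A rs y) \<subseteq> inversions u"
    using Cons.prems(5) by (simp add: y_def)
  have "\<exists>P'. (\<forall>c. c \<notin> set (rs @ ls) \<longrightarrow> (c \<in> P' \<longleftrightarrow> c \<in> P)) \<and>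
      P' \<subseteq> P \<and> read_boxes P' (rs @ ls) y = u"
  proof (cases "read_box P b x = y")
    case True
    then show ?thesis using Cons.prems(4) by (intro exI[of _ P]) auto
  next
    case False
    define k where "k = box_pos b"
    have b: "b \<in> A" "b \<notin> P" "x k < x (Suc k)"
      using False Cons.prems(3)
      by (auto simp: y_def read_box_def k_def hecke_step_def split: if_splits)
    then have y: "y = x \<circ> transpose k (Suc k)"
      by (auto simp: y_def read_box_def k_def hecke_step_def)
    have u: "read_boxes P (rs @ ls) x = u"
      using Cons.prems(4) b by (simp add: read_box_def[of P b])
    have "(x (Suc k), x k) \<in> inversions y" using b by (simp add: y inversions_swap)
    then have "(x (Suc k), x k) \<in> inversions u"
      using sub inversions_read_boxes_mono by blast
    then have "\<exists>P' \<subseteq> P. P - P' \<subseteq> set (rs @ ls) \<and>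
        read_boxes P' (rs @ ls) (x \<circ> transpose k (Suc k)) = read_boxes P (rs @ ls) x"
      using Cons.prems b u by (intro exchange) auto
    then show ?thesis using y u by blast
  qed
  then obtain P' where P': "\<forall>c. c \<notin> set (rs @ ls) \<longrightarrow> (c \<in> P' \<longleftrightarrow> c \<in> P)"
      "P' \<subseteq> P" "read_boxes P' (rs @ ls) y = u" by blast
  have "\<exists>Q. (\<forall>c. c \<notin> set (rs @ ls) \<longrightarrow> (c \<in> Q \<longleftrightarrow> c \<in> P')) \<and>
           (\<forall>c \<in> set rs. c \<in> Q \<longleftrightarrow> c \<in> A) \<and> Q \<inter> set ls \<subseteq> P' \<and>
           read_boxes Q (rs @ ls) y = u"
    using Cons.prems P' \<open>bij y\<close> sub by (intro Cons.IH) auto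
  then obtain Q where Q: "\<And>c. c \<notin> set (rs @ ls) \<Longrightarrow> (c \<in> Q \<longleftrightarrow> c \<in> P')"
      "\<And>c. c \<in> set rs \<Longrightarrow> c \<in> Q \<longleftrightarrow> c \<in> A" "Q \<inter> set ls \<subseteq> P'"
      "read_boxes Q (rs @ ls) y = u" by blast
  define R where "R = (if b \<in> A then insert b Q else Q - {b})"
  have b: "b \<notin> set (rs @ ls)" using Cons.prems(2) by auto
  have "read_boxes R (rs @ ls) y = u"
    unfolding Q(4)[symmetric] using b by (intro read_boxes_cong) (auto simp: R_def)
  moreover have "read_box R b x = y" by (auto simp: y_def read_box_def R_def)
  ultimately have "read_boxes R ((b # rs) @ ls) x = u" by simp
  moreover have "\<forall>c. c \<notin> set ((b # rs) @ ls) \<longrightarrow> (c \<in> R \<longleftrightarrow> c \<in> P)"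
    using Q(1) P'(1) by (auto simp: R_def)
  moreover have "\<forall>c \<in> set (b # rs). c \<in> R \<longleftrightarrow> c \<in> A"
    using Q(2) b by (auto simp: R_def)
  moreover have "R \<inter> set ls \<subseteq> P" using Q(3) P'(2) b by (auto simp: R_def)
  ultimately show ?case by blast
qed

section \<open>A single row\<close>

text \<open>
  In the row starting at the pipes \<open>v\<close>, with crosses at the positions \<open>S\<close>, a cross passes on the
  larger of the two pipes and a bump the one from the top. The recursion follows the row from
  position \<open>n\<close> to the left; its argument is the distance from \<open>n\<close>.
\<close>

primrec carry :: "nat set \<Rightarrow> (nat \<Rightarrow> nat) \<Rightarrow> nat \<Rightarrow> nat \<Rightarrow> nat" where
  "carry S v n 0 = v n"
| "carry S v n (Suc t) =
     (if n - Suc t \<in> S then max (v (n - Suc t)) (carry S v n t) else v (n - Suc t))"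

text \<open>
  The pipe that enters the box at position \<open>k - 1\<close> from the right; for the first position of the row,
  the pipe that leaves the grid.
\<close>

definition carried :: "nat set \<Rightarrow> (nat \<Rightarrow> nat) \<Rightarrow> nat \<Rightarrow> nat \<Rightarrow> nat" where
  "carried S v n k = carry S v n (n - k)"

lemma carried_last: "carried S v n n = v n"
  by (simp add: carried_def)

lemma carried_rec:
  assumes "k < n"
  shows "carried S v n k = (if k \<in> S then max (v k) (carried S v n (Suc k)) else v k)"
proof -
  have "n - k = Suc (n - Suc k)" "n - Suc (n - Suc k) = k" using assms by auto
  then show ?thesis by (simp add: carried_def)
qed

definition row_boxes :: "nat \<Rightarrow> nat \<Rightarrow> (nat \<times> nat) list" where
  "row_boxes n i = map (Pair i) (rev [1..<n + 1 - i])"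

definition cross_positions :: "diagram \<Rightarrow> nat \<Rightarrow> nat set" where
  "cross_positions P i = box_pos ` {b \<in> P. fst b = i \<and> 1 \<le> snd b}"

lemma cross_positions_iff:
  assumes "1 \<le> i" "1 \<le> j"
  shows "i + j - 1 \<in> cross_positions P i \<longleftrightarrow> (i, j) \<in> P"
proof
  assume "i + j - 1 \<in> cross_positions P i"
  then obtain j' where "(i, j') \<in> P" "1 \<le> j'" "i + j - 1 = i + j' - 1"
    by (auto simp: cross_positions_def box_pos_def)
  moreover from this have "j' = j" using assms by simp
  ultimately show "(i, j) \<in> P" by simp
next
  assume "(i, j) \<in> P"
  then have "box_pos (i, j) \<in> cross_positions P i"
    unfolding cross_positions_def using assms by (intro imageI) auto
  then show "i + j - 1 \<in> cross_positions P i" by (simp add: box_pos_def)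
qed

text \<open>
  After \<open>t\<close> boxes of row \<open>a\<close>, the positions to the left are untouched and the next one holds the
  carried pipe; hence each effective cross inverts the carried pipe with an original entry of \<open>v\<close>.
\<close>

lemma read_part_of_row:
  fixes P v n a
  defines "S \<equiv> cross_positions P a"
  defines "h \<equiv> carried S v n"
  assumes a: "1 \<le> a" "a \<le> n" and t: "t \<le> n - a"
  defines "y \<equiv> read_boxes P (map (Pair a) (rev [n + 1 - a - t..<n + 1 - a])) v"
  shows "(\<forall>l < n - t. y l = v l) \<and> y (n - t) = h (n - t) \<and>
    inversions y = inversions v \<union>
      {(h (Suc k), v k) | k. n - t \<le> k \<and> k < n \<and> k \<in> S \<and> v k < h (Suc k)}"
  using t unfolding y_def
proof (induction t)
  case 0
  then show ?case by (auto simp: h_def carried_last)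
next
  case (Suc t)
  define j where "j = n - a - t"
  define k where "k = n - Suc t"
  have kj: "a + j - 1 = k" "1 \<le> j" "a \<le> k" "k < n" "n - t = Suc k" "n - Suc t = k"
    using Suc.prems a by (auto simp: j_def k_def)
  define y where "y = read_boxes P (map (Pair a) (rev [n + 1 - a - t..<n + 1 - a])) v"
  have IH: "\<And>l. l < Suc k \<Longrightarrow> y l = v l" "y (Suc k) = h (Suc k)"
     "inversions y = inversions v \<union>
       {(h (Suc l), v l) | l. Suc k \<le> l \<and> l < n \<and> l \<in> S \<and> v l < h (Suc l)}"
    using Suc kj by (auto simp: y_def)
  have j: "n + 1 - a - Suc t = j" "n + 1 - a - t = Suc j" "j < n + 1 - a"
    using Suc.prems a by (auto simp: j_def)
  have split: "rev [n + 1 - a - Suc t..<n + 1 - a] = rev [n + 1 - a - t..<n + 1 - a] @ [j]"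
    using j by (simp add: upt_conv_Cons)
  have "(a, j) \<in> P \<longleftrightarrow> k \<in> S" using cross_positions_iff[of a j P] a kj by (simp add: S_def)
  then have z: "read_boxes P (map (Pair a) (rev [n + 1 - a - Suc t..<n + 1 - a])) v =
      (if k \<in> S then hecke_step k y else y)"
    unfolding split by (simp add: y_def read_box_def box_pos_def kj[unfolded One_nat_def])
  have yk: "y k = v k" using IH by simp
  have new_pairs: "{(h (Suc l), v l) | l. k \<le> l \<and> l < n \<and> l \<in> S \<and> v l < h (Suc l)} =
    {(h (Suc l), v l) | l. Suc k \<le> l \<and> l < n \<and> l \<in> S \<and> v l < h (Suc l)} \<union>
    (if k \<in> S \<and> v k < h (Suc k) then {(h (Suc k), v k)} else {})"
    using kj by (auto simp: le_eq_less_or_eq Suc_le_eq)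
  have hk: "h k = (if k \<in> S then max (v k) (h (Suc k)) else v k)"
    unfolding h_def using kj by (simp add: carried_rec)
  show ?case
    unfolding z kj new_pairs
  proof (intro conjI allI impI)
    show "(if k \<in> S then hecke_step k y else y) l = v l" if "l < k" for l
      using IH(1) that by (simp add: hecke_step_other)
    show "(if k \<in> S then hecke_step k y else y) k = h k"
      using yk IH(2) by (simp add: hk hecke_step_at)
    show "inversions (if k \<in> S then hecke_step k y else y) = inversions v \<union>
      ({(h (Suc l), v l) | l. Suc k \<le> l \<and> l < n \<and> l \<in> S \<and> v l < h (Suc l)} \<union>
       (if k \<in> S \<and> v k < h (Suc k) then {(h (Suc k), v k)} else {}))"
      unfolding Un_assoc[symmetric] IH(3)[symmetric]
      using yk IH(2) by (simp add: inversions_hecke_step)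
  qed
qed

text \<open>
  This reduces the effect of a row to a comparison of the carried pipes with the entries of \<open>v\<close>, both
  for the given row and for the row with an additional cross.
\<close>

lemma inversions_read_row:
  fixes P v n a
  defines "h \<equiv> carried (cross_positions P a) v n"
  assumes "1 \<le> a" "a \<le> n"
  shows "inversions (read_boxes P (row_boxes n a) v) = inversions v \<union>
     {(h (Suc k), v k) | k. a \<le> k \<and> k < n \<and> k \<in> cross_positions P a \<and> v k < h (Suc k)}"
  using read_part_of_row[of a n "n - a" P v] assms
  by (simp add: row_boxes_def h_def)

section \<open>A position for the new cross\<close>

lemma ascent_between:
  fixes f :: "nat \<Rightarrow> nat"
  assumes "i < j" "f i < f j"
  shows "\<exists>k. i \<le> k \<and> k < j \<and> f k < f (Suc k)"
proof (rule ccontr)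
  assume "\<not> ?thesis"
  then have "f (i + t) \<le> f i" if "i + t \<le> j" for t
    using that by (induction t) (auto, meson le_add1 le_trans linorder_not_less Suc_le_eq)
  from this[of "j - i"] show False using assms by simp
qed

text \<open>
  Here \<open>v\<close> and \<open>w\<close> list the pipes before row \<open>a\<close> and at the end, and \<open>S\<close> is the set of positions of
  the crosses of row \<open>a\<close>. The assumptions \<open>old\<close> and \<open>row\<close> state that all inversions of \<open>v\<close> and all
  inversions created by the row survive in \<open>w\<close>; the conclusion states the same for the row with
  a further cross at \<open>d\<close>. A block consists of a maximal sequence of consecutive crosses and the bump
  to the right of it; the pipe carried to its left end is its maximum.

  Adding a cross at the bump \<open>d\<close> lets the pipe \<open>q\<close> from the right enter the block. The only new
  inversions are those of \<open>q\<close> with the entries \<open>v k\<close> of the block such that \<open>q\<close> exceeds all of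
  \<open>v k, \<dots>, v d\<close>. If such an inversion is missing in \<open>w\<close>, then \<open>w\<close> has \<open>v k\<close> before the larger \<open>q\<close>, so
  there is an ascent between them. As the maximum of the block is inverted with \<open>v k\<close> or equal to it,
  it comes no later than \<open>v k\<close>. So the ascent lies between the positions in \<open>w\<close> of the maximum of the
  block and of \<open>q\<close>, the maximum of the next block. The intervals for different bumps are disjoint,
  and so the bumps are at most as many as the ascents.
\<close>

lemma insertable_position:
  fixes n a :: nat and v w :: "nat \<Rightarrow> nat" and S :: "nat set"
  defines "h \<equiv> \<lambda>S. carried S v n"
  assumes "bij w" and "a \<le> n"
    and range: "\<And>k. a \<le> k \<Longrightarrow> k \<le> n \<Longrightarrow> a \<le> inv w (v k) \<and> inv w (v k) \<le> n"
    and old: "inversions v \<subseteq> inversions w"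
    and row: "\<And>k. a \<le> k \<Longrightarrow> k < n \<Longrightarrow> k \<in> S \<Longrightarrow> v k < h S (Suc k) \<Longrightarrow>
                (h S (Suc k), v k) \<in> inversions w"
    and few: "card (S \<inter> {a..<n}) < card {i \<in> {a..<n}. w (Suc i) < w i}"
  shows "\<exists>d \<in> {a..<n} - S. \<forall>k \<in> {a..<n} \<inter> insert d S. v k < h (insert d S) (Suc k) \<longrightarrow>
           (h (insert d S) (Suc k), v k) \<in> inversions w"
proof (rule ccontr)
  assume stuck: "\<not> ?thesis"
  have rec: "h S k = (if k \<in> S then max (v k) (h S (Suc k)) else v k)" if "k < n" for k S
    unfolding h_def using that by (rule carried_rec)
  have last: "h S n = v n" for S
    unfolding h_def by (rule carried_last)
  define pos where "pos = inv w"
  have wpos: "w (pos y) = y" for y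
    unfolding pos_def using \<open>bij w\<close> by (simp add: bij_is_surj surj_f_inv_f)
  have inv_iff: "(p, q) \<in> inversions w \<longleftrightarrow> q < p \<and> pos p < pos q" for p q
    unfolding pos_def using \<open>bij w\<close> by (rule inversions_iff)
  \<comment> \<open>A carried pipe is equal to or inverted with each entry of its block that it has passed.\<close>
  have lead: "v k \<le> h S c \<and> pos (h S c) \<le> pos (v k)"
    if "a \<le> c" "c \<le> k" "k \<le> n" "{c..<k} \<subseteq> S" for c k
    using that(2,1,4)
  proof (induction rule: inc_induct)
    case base
    show ?case
    proof (cases "k < n \<and> k \<in> S \<and> v k < h S (Suc k)")
      case True
      then show ?thesis using row[of k] rec[of k S] base by (auto simp: inv_iff max_def)
    next
      case False
      then have "h S k = v k" using rec[of k S] last that(3) by (cases "k = n") auto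
      then show ?thesis by simp
    qed
  next
    case (step c)
    have c: "c \<in> S" "c < n" using step that by auto
    have IH: "v k \<le> h S (Suc c)" "pos (h S (Suc c)) \<le> pos (v k)"
      using step.IH step.prems by (auto simp: subset_iff)
    show ?case
    proof (cases "h S (Suc c) < v c")
      case True
      then have "(v c, v k) \<in> inversions w"
        using old inversionsI[of c k v] IH step by auto
      then show ?thesis using True rec[of c S] c by (auto simp: inv_iff)
    next
      case False
      then show ?thesis using IH rec[of c S] c by (auto simp: max_def)
    qed
  qed
  \<comment> \<open>The left end of the block that contains \<open>d\<close>.\<close>
  define start where "start d = (LEAST c. a \<le> c \<and> {c..<d} \<subseteq> S)" for d
  have start: "a \<le> start d" "start d \<le> d" "{start d..<d} \<subseteq> S"
      "a < start d \<Longrightarrow> start d - 1 \<notin> S" if "a \<le> d" for d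
  proof -
    have ex: "a \<le> d \<and> {d..<d} \<subseteq> S" using that by simp
    show 1: "a \<le> start d" "{start d..<d} \<subseteq> S"
      using LeastI[of "\<lambda>c. a \<le> c \<and> {c..<d} \<subseteq> S", OF ex] by (auto simp: start_def)
    show 2: "start d \<le> d"
      unfolding start_def by (rule Least_le[of "\<lambda>c. a \<le> c \<and> {c..<d} \<subseteq> S", OF ex])
    show "start d - 1 \<notin> S" if "a < start d"
    proof
      assume "start d - 1 \<in> S"
      moreover have "{start d - 1..<d} \<subseteq> insert (start d - 1) {start d..<d}" by auto
      ultimately have "{start d - 1..<d} \<subseteq> S" using 1 by blast
      then have "start d \<le> start d - 1"
        unfolding start_def using that
        by (intro Least_le[of "\<lambda>c. a \<le> c \<and> {c..<d} \<subseteq> S"]) (auto simp: start_def)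
      then show False using that by simp
    qed
  qed
  have ascent: "\<exists>i. pos (h S (start d)) \<le> i \<and> i < pos (h S (Suc d)) \<and> w i < w (Suc i)"
    if d: "a \<le> d" "d < n" "d \<notin> S" for d
  proof -
    define T where "T = insert d S"
    define q where "q = h S (Suc d)"
    note st = start[OF d(1)]
    \<comment> \<open>The additional cross at \<open>d\<close> changes the carried pipes only within the block of \<open>d\<close>.\<close>
    have right: "h T k = h S k" if "d < k" "k \<le> n" for k
      using that(2,1)
    proof (induction rule: inc_induct)
      case base
      then show ?case by (simp add: last)
    next
      case (step k)
      then show ?case using rec[of k T] rec[of k S] by (simp add: T_def)
    qed
    have block: "h T k = max (h S k) q" if "start d \<le> k" "k \<le> d" for k
      using that(2,1)
    proof (induction rule: inc_induct)
      case base
      then show ?case using rec[of d T] rec[of d S] right[of "Suc d"] d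
        by (simp add: T_def q_def)
    next
      case (step k)
      then have "k \<in> S" using st by auto
      then show ?case using rec[of k T] rec[of k S] step d by (auto simp: T_def)
    qed
    have left: "h T k = h S k" if "a \<le> k" "k < start d" for k
    proof -
      have "k \<le> start d - 1" using that by simp
      then show ?thesis using that(1)
      proof (induction rule: inc_induct)
        case base
        then have "start d - 1 \<notin> T" "start d - 1 < n" using st d that by (auto simp: T_def)
        then show ?case using rec[of "start d - 1" T] rec[of "start d - 1" S]
          by (simp add: T_def)
      next
        case (step k)
        then show ?case using rec[of k T] rec[of k S] d st by (simp add: T_def)
      qed
    qed
    have "d \<in> {a..<n} - S" using d by simp
    then have "\<not> (\<forall>k \<in> {a..<n} \<inter> T. v k < h T (Suc k) \<longrightarrow> (h T (Suc k), v k) \<in> inversions w)"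
      unfolding T_def using stuck by blast
    then obtain k where k: "a \<le> k" "k < n" "k \<in> T" "v k < h T (Suc k)"
        "(h T (Suc k), v k) \<notin> inversions w"
      by auto
    have neq: "\<not> (k \<in> S \<and> h T (Suc k) = h S (Suc k))" using k row[of k] by auto
    have kd: "start d \<le> k" "k \<le> d"
    proof -
      show "k \<le> d"
      proof (rule ccontr)
        assume "\<not> k \<le> d"
        then show False using neq right[of "Suc k"] k by (auto simp: T_def)
      qed
      show "start d \<le> k"
      proof (rule ccontr)
        assume "\<not> start d \<le> k"
        then have less: "k < start d" by simp
        then have "k \<in> S" using k st d by (auto simp: T_def)
        then have "k \<noteq> start d - 1" using st less k by auto
        then show False using neq left[of "Suc k"] \<open>k \<in> S\<close> k less by auto
      qed
    qed
    \<comment> \<open>Otherwise the inversion would be created by the original row already.\<close>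
    have hq: "h T (Suc k) = q"
    proof (cases "k = d")
      case True
      then show ?thesis using right[of "Suc d"] d by (simp add: q_def)
    next
      case False
      then have "k \<in> S" using k by (simp add: T_def)
      then show ?thesis
        using neq block[of "Suc k"] kd False by (auto simp: max_def split: if_splits)
    qed
    have lt: "v k < q" and "\<not> pos q < pos (v k)" using k hq by (auto simp: inv_iff)
    then have pq: "pos (v k) < pos q" using wpos by (metis nat_neq_iff)
    obtain i where "pos (v k) \<le> i" "i < pos q" "w i < w (Suc i)"
      using ascent_between[of "pos (v k)" "pos q" w] pq lt by (auto simp: wpos)
    moreover have "pos (h S (start d)) \<le> pos (v k)"
    proof -
      have "{start d..<k} \<subseteq> S" using st kd by auto
      then show ?thesis using lead[of "start d" k] st kd d by simp
    qed
    ultimately show ?thesis unfolding q_def by (meson le_trans)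
  qed
  have hrange: "a \<le> pos (h S k) \<and> pos (h S k) \<le> n" if "a \<le> k" "k \<le> n" for k
    using that(2,1)
  proof (induction rule: inc_induct)
    case base
    then show ?case using range[of n] by (simp add: last pos_def)
  next
    case (step k)
    then show ?case using range[of k] rec[of k S] by (auto simp: pos_def max_def)
  qed
  \<comment> \<open>Induction from block to block; the condition on \<open>k\<close> says that a block starts there.\<close>
  have count: "card ({a..<k} - S) \<le> card {i \<in> {a..<pos (h S k)}. w i < w (Suc i)}"
    if "a \<le> k" "k \<le> n" "k = a \<or> k - 1 \<notin> S" for k
    using that
  proof (induction k rule: less_induct)
    case (less k)
    show ?case
    proof (cases "k = a")
      case True
      then show ?thesis by simp
    next
      case False
      define d where "d = k - 1"
      have d: "a \<le> d" "d < n" "d \<notin> S" "k = Suc d" using False less.prems by (auto simp: d_def)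
      note st = start[OF d(1)]
      define c where "c = start d"
      obtain i where i: "pos (h S c) \<le> i" "i < pos (h S k)" "w i < w (Suc i)"
        using ascent[OF d(1-3)] by (auto simp: d c_def)
      have ai: "a \<le> i" using i hrange[of c] st d by (auto simp: c_def)
      have "{a..<k} - S = insert d ({a..<c} - S)"
        using st d by (auto simp: c_def) (metis atLeastLessThan_iff in_mono less_Suc_eq not_le)
      then have "card ({a..<k} - S) \<le> Suc (card ({a..<c} - S))"
        by (simp add: card_insert_if)
      also have "card ({a..<c} - S) \<le> card {i \<in> {a..<pos (h S c)}. w i < w (Suc i)}"
      proof (rule less.IH)
        show "c < k" "a \<le> c" "c \<le> n" using st d by (auto simp: c_def)
        show "c = a \<or> c - 1 \<notin> S" using st by (auto simp: c_def)
      qed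
      also have "Suc (card {i \<in> {a..<pos (h S c)}. w i < w (Suc i)}) =
          card (insert i {i \<in> {a..<pos (h S c)}. w i < w (Suc i)})"
        using i by simp
      also have "\<dots> \<le> card {i \<in> {a..<pos (h S k)}. w i < w (Suc i)}"
        using i ai by (intro card_mono) auto
      finally show ?thesis by simp
    qed
  qed
  define c where "c = start n"
  note st = start[OF \<open>a \<le> n\<close>]
  have "card ({a..<n} - S) \<le> card ({a..<c} - S)"
    using st by (intro card_mono) (auto simp: c_def subset_iff not_less)
  also have "\<dots> \<le> card {i \<in> {a..<pos (h S c)}. w i < w (Suc i)}"
    using st by (intro count) (auto simp: c_def)
  also have "\<dots> \<le> card {i \<in> {a..<n}. w i < w (Suc i)}"
    using hrange[of c] st by (intro card_mono) (auto simp: c_def)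
  also have "\<dots> \<le> card ({a..<n} - {i \<in> {a..<n}. w (Suc i) < w i})"
    by (intro card_mono) auto
  also have "\<dots> = card {a..<n} - card {i \<in> {a..<n}. w (Suc i) < w i}"
    by (intro card_Diff_subset) auto
  also have "card ({a..<n} - S) = card {a..<n} - card ({a..<n} \<inter> S)"
    by (intro card_Diff_subset_Int) simp
  finally have "card {a..<n} - card ({a..<n} \<inter> S) \<le>
      card {a..<n} - card {i \<in> {a..<n}. w (Suc i) < w i}" .
  moreover have "card {i \<in> {a..<n}. w (Suc i) < w i} \<le> card {a..<n}"
    by (intro card_mono) auto
  ultimately show False using few by (simp add: Int_commute)
qed

section \<open>Fireworks permutations\<close>

text \<open>
  A longest decreasing interval around \<open>t\<close> is maximal.
\<close>

lemma in_decreasing_run: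
  assumes "t \<in> {1..n}"
  shows "\<exists>a b. decreasing_run n w a b \<and> a \<le> t \<and> t \<le> b"
proof -
  define R where "R = {(a, b). 1 \<le> a \<and> a \<le> t \<and> t \<le> b \<and> b \<le> n \<and> strict_antimono_on {a..b} w}"
  have "R \<subseteq> {1..n} \<times> {1..n}" by (auto simp: R_def)
  then have fin: "finite R" by (rule finite_subset) simp
  have "(t, t) \<in> R" using assms by (auto simp: R_def monotone_on_def)
  then have "R \<noteq> {}" by auto
  obtain a b where in_R: "(a, b) \<in> R"
    and Max: "Max ((\<lambda>(a, b). b - a) ` R) = b - a"
    using obtains_MAX[OF fin \<open>R \<noteq> {}\<close>, of "\<lambda>(a, b). b - a"] by auto
  have max: "b' - a' \<le> b - a" if "(a', b') \<in> R" for a' b'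
    using Max_ge[of "(\<lambda>(a, b). b - a) ` R" "b' - a'"] fin that by (force simp: Max)
  have "decreasing_run n w a b"
    unfolding decreasing_run_def
  proof (intro conjI allI impI)
    fix a' b'
    assume "1 \<le> a' \<and> a' \<le> a \<and> b \<le> b' \<and> b' \<le> n \<and> strict_antimono_on {a'..b'} w"
    moreover from this have "(a', b') \<in> R" using in_R by (auto simp: R_def)
    from max[OF this] have "b' - a' \<le> b - a" .
    ultimately show "a' = a" "b' = b" using in_R by (auto simp: R_def)
  qed (use in_R in \<open>auto simp: R_def\<close>)
  then show ?thesis using in_R by (auto simp: R_def)
qed

text \<open>
  The run containing \<open>i\<close> has an initial term of at least \<open>w i\<close>, and \<open>j + 1\<close> starts a later run.
\<close>

lemma fireworks_avoids:
  assumes "fireworks n w" and "1 \<le> i" "i < j" "j < n"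
    and "w j < w (Suc j)"
  shows "w i \<le> w (Suc j)"
proof -
  obtain a b where ab: "decreasing_run n w a b" "a \<le> i" "i \<le> b"
    using in_decreasing_run[of i n w] assms by auto
  obtain c d where cd: "decreasing_run n w c d" "c \<le> Suc j" "Suc j \<le> d"
    using in_decreasing_run[of "Suc j" n w] assms by auto
  have "c = Suc j"
  proof (rule ccontr)
    assume "c \<noteq> Suc j"
    then have "j \<in> {c..d}" "Suc j \<in> {c..d}" using cd by auto
    moreover have "strict_antimono_on {c..d} w" using cd(1) by (simp add: decreasing_run_def)
    ultimately have "w (Suc j) < w j" by (metis monotone_onD lessI)
    then show False using assms by simp
  qed
  moreover have "a < c" using ab assms \<open>c = Suc j\<close> by simp
  ultimately have "w a < w (Suc j)"
    using assms(1) ab(1) cd(1) unfolding fireworks_def by blast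
  moreover have "w i \<le> w a"
  proof (cases "a = i")
    case False
    then have "a \<in> {a..b}" "i \<in> {a..b}" "a < i" using ab by auto
    moreover have "strict_antimono_on {a..b} w" using ab(1) by (simp add: decreasing_run_def)
    ultimately have "w i < w a" by (metis monotone_onD)
    then show ?thesis by simp
  qed simp
  ultimately show ?thesis by simp
qed

text \<open>
  If column \<open>j\<close> of the closure reaches row \<open>a\<close>, some \<open>w i > j\<close> with \<open>i \<ge> a\<close> precedes the entry \<open>j\<close> of \<open>w\<close>.
  The entry immediately before \<open>j\<close> is then larger than \<open>j\<close> too, as otherwise these three entries would
  form a pattern excluded by \<open>fireworks_avoids\<close>.
\<close>

lemma wt_closure_le_descents:
  assumes w: "w permutes {1..n}" and "fireworks n w" and "1 \<le> a"
  shows "wt (upward_closure n n (rothe_diagram n w)) a \<le> card {i \<in> {a..<n}. w (Suc i) < w i}"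
proof -
  let ?J = "{j. (a, j) \<in> upward_closure n n (rothe_diagram n w)}"
  have "(\<exists>p. inv w j = Suc p \<and> a \<le> p \<and> p < n \<and> w (Suc p) < w p) \<and> w (inv w j) = j"
    if j: "j \<in> ?J" for j
  proof -
    obtain i where i: "a \<le> i" "j \<in> {1..n}" "i \<in> {1..n}" "i < inv w j" "j < w i"
      using j by (auto simp: upward_closure_def rothe_diagram_def)
    have wj: "w (inv w j) = j" using w by (rule permutes_inverses)
    have "inv w j \<in> {1..n}" 
      using permutes_in_image[OF permutes_inv[OF w]] i(2) by blast
    then obtain p where p: "inv w j = Suc p" "p < n" using i by (cases "inv w j") auto
    have "w (Suc p) < w p"
    proof (rule ccontr)
      assume "\<not> w (Suc p) < w p"
      moreover have "w (Suc p) \<noteq> w p" using w by (metis n_not_Suc_n permutes_inj inj_eq)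
      ultimately have asc: "w p < w (Suc p)" by simp
      have "i < p" using i p wj asc by (cases "i = p") auto
      then have "w i \<le> w (Suc p)"
        using fireworks_avoids[OF assms(2), of i p] asc i p by auto
      then show False using i wj p by simp
    qed
    then show ?thesis using p i wj by auto
  qed
  note * = this
  have "inj_on (\<lambda>j. inv w j - 1) ?J"
    by (rule inj_onI) (metis * diff_Suc_1)
  moreover have "(\<lambda>j. inv w j - 1) ` ?J \<subseteq> {i \<in> {a..<n}. w (Suc i) < w i}"
    using * by fastforce
  ultimately show ?thesis unfolding wt_def by (intro card_inj_on_le) auto
qed

section \<open>Tracing pipes\<close>

definition rows_boxes :: "nat \<Rightarrow> nat list \<Rightarrow> (nat \<times> nat) list" where
  "rows_boxes n rows = concat (map (row_boxes n) rows)"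

text \<open>
  The state of the tracing procedure in row \<open>i\<close> when the columns \<open>> j\<close> have been processed: the columns
  up to \<open>j\<close> still refer to top edges, at positions \<open>i + l - 1\<close>; then comes the vertical edge; the columns
  beyond \<open>j\<close> refer to bottom edges, which are one position further right.
\<close>

definition trace_matches :: "nat \<Rightarrow> nat \<Rightarrow> nat \<Rightarrow> trace_state \<Rightarrow> (nat \<Rightarrow> nat) \<Rightarrow> bool" where
  "trace_matches n i j s x \<longleftrightarrow> (case s of (v, h, X) \<Rightarrow>
     (\<forall>l. 1 \<le> l \<and> l \<le> j \<longrightarrow> v l = x (i + l - 1)) \<and> h = x (i + j) \<and>
     (\<forall>l. j < l \<and> l \<le> n - i \<longrightarrow> v l = x (i + l)) \<and>
     (\<forall>p q. q < p \<longrightarrow> {p, q} \<in> X \<longleftrightarrow> (p, q) \<in> inversions x))"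

lemma trace_tile_matches:
  assumes "trace_matches n i (Suc j) s x" "bij x" "1 \<le> i"
  shows "trace_matches n i j (trace_tile P i (Suc j) s) (read_box P (i, Suc j) x)"
proof -
  obtain v h X where s: "s = (v, h, X)" by (cases s)
  define k where "k = i + j"
  have v1: "\<And>l. 1 \<le> l \<Longrightarrow> l \<le> Suc j \<Longrightarrow> v l = x (i + l - 1)"
    and h: "h = x (Suc k)" 
    and v2: "\<And>l. Suc j < l \<Longrightarrow> l \<le> n - i \<Longrightarrow> v l = x (i + l)"
    and X: "\<And>p q. q < p \<Longrightarrow> {p, q} \<in> X \<longleftrightarrow> (p, q) \<in> inversions x"
    using assms(1) by (auto simp: trace_matches_def s k_def)
  have vj: "v (Suc j) = x k" using v1[of "Suc j"] by (simp add: k_def)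
  have ne: "x k \<noteq> x (Suc k)" using assms(2) by (metis bij_is_inj inj_eq n_not_Suc_n)
  have crossed: "{v (Suc j), h} \<in> X \<longleftrightarrow> x (Suc k) < x k"
  proof (cases "x (Suc k) < x k")
    case True
    then have "(x k, x (Suc k)) \<in> inversions x" by (intro inversionsI) auto
    then show ?thesis using X True by (simp add: vj h)
  next
    case False
    then have less: "x k < x (Suc k)" using ne by simp
    have "(x (Suc k), x k) \<notin> inversions x"
      using assms(2) by (simp add: inversions_iff bij_is_inj inv_f_f)
    then show ?thesis using X[OF less] less by (simp add: vj h insert_commute)
  qed
  have box: "box_pos (i, Suc j) = k" by (simp add: box_pos_def k_def)
  show ?thesis
  proof (cases "(i, Suc j) \<in> P \<and> x k < x (Suc k)")
    case True
    then have s': "trace_tile P i (Suc j) s = (v, h, insert {v (Suc j), h} X)"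
      using crossed by (simp add: trace_tile_def s)
    have x': "read_box P (i, Suc j) x = x \<circ> transpose k (Suc k)"
      using True box by (simp add: read_box_def hecke_step_def)
    have "{p, q} \<in> insert {v (Suc j), h} X \<longleftrightarrow> (p, q) \<in> inversions (x \<circ> transpose k (Suc k))"
      if "q < p" for p q
      using X[OF that] True that by (auto simp: inversions_swap vj h doubleton_eq_iff)
    moreover have "v l = x (transpose k (Suc k) (i + l - 1))" if "1 \<le> l" "l \<le> j" for l
      using v1[of l] that by (auto simp: k_def transpose_def)
    moreover have "h = x (transpose k (Suc k) (i + j))" by (simp add: h k_def)
    moreover have "v l = x (transpose k (Suc k) (i + l))" if "j < l" "l \<le> n - i" for l
    proof (cases "l = Suc j")
      case True
      then show ?thesis by (simp add: vj k_def)
    next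
      case False
      then show ?thesis using v2[of l] that by (auto simp: k_def transpose_def)
    qed
    ultimately show ?thesis unfolding s' x' trace_matches_def by auto
  next
    case False
    then have s': "trace_tile P i (Suc j) s = (v(Suc j := h), v (Suc j), X)"
      using crossed ne by (auto simp: trace_tile_def s)
    have x': "read_box P (i, Suc j) x = x"
      using False box by (auto simp: read_box_def hecke_step_def)
    show ?thesis unfolding s' x' trace_matches_def
      using v1 v2 vj X by (auto simp: h k_def)
  qed
qed

lemma trace_tiles_match:
  assumes "trace_matches n i j s x" "bij x" "1 \<le> i"
  shows "trace_matches n i 0 (fold (trace_tile P i) (rev [1..<Suc j]) s)
           (read_boxes P (map (Pair i) (rev [1..<Suc j])) x)"
  using assms
proof (induction j arbitrary: s x)
  case (Suc j)
  have "bij (read_box P (i, Suc j) x)"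
    using Suc.prems by (auto simp: read_box_def bij_hecke_step)
  then show ?case
    using Suc.IH[OF trace_tile_matches[OF Suc.prems]] Suc.prems(3) by simp
qed simp

text \<open>
  The bottom edges of a row are the top edges of the next one, at the same positions \<open>i + l\<close>, so only
  the half-bump has to be accounted for: it makes the last column the first carried pipe.
\<close>

lemma trace_rows_match:
  assumes "0 < i" and "i \<le> n"
  shows "trace_matches n i 0 (trace_rows n P i) (read_boxes P (rows_boxes n [1..<Suc i]) (\<lambda>k. k))"
  using assms
proof (induction i)
  case (Suc i)
  define x where "x = read_boxes P (rows_boxes n [1..<Suc i]) (\<lambda>k. k)"
  obtain v h X where s: "trace_rows n P i = (v, h, X)" by (cases "trace_rows n P i")
  have "bij x" unfolding x_def by (intro bij_read_boxes) (simp add: bij_id[unfolded id_def])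
  have prev: "(\<forall>l. 1 \<le> l \<and> l \<le> n - i \<longrightarrow> v l = x (i + l)) \<and>
     (\<forall>p q. q < p \<longrightarrow> {p, q} \<in> X \<longleftrightarrow> (p, q) \<in> inversions x)"
  proof (cases "i = 0")
    case True
    then show ?thesis using s by (auto simp: x_def rows_boxes_def inversions_id)
  next
    case False
    then show ?thesis using Suc s by (auto simp: trace_matches_def x_def)
  qed
  have "trace_matches n (Suc i) (n - Suc i) (v, v (n + 1 - Suc i), X) x"
    using prev Suc.prems by (auto simp: trace_matches_def)
  from trace_tiles_match[OF this \<open>bij x\<close>, of P]
  have "trace_matches n (Suc i) 0 (trace_rows n P (Suc i)) (read_boxes P (row_boxes n (Suc i)) x)"
    using Suc.prems by (simp add: trace_row_def s row_boxes_def Suc_diff_Suc)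
  then show ?case by (simp add: x_def rows_boxes_def)
qed simp

lemma set_rows_boxes:
  "set (rows_boxes n rows) = {(i, j). i \<in> set rows \<and> 1 \<le> j \<and> j < n + 1 - i}"
  by (auto simp: rows_boxes_def row_boxes_def)

text \<open>
  Rows below \<open>r\<close> act on positions greater than \<open>r\<close> only, so the pipe that leaves in row \<open>r\<close> stays
  at position \<open>r\<close> until the end.
\<close>

lemma pd_perm_eq: "pd_perm n P = read_boxes P (rows_boxes n [1..<Suc n]) (\<lambda>k. k)"
proof
  fix r
  show "pd_perm n P r = read_boxes P (rows_boxes n [1..<Suc n]) (\<lambda>k. k) r"
  proof (cases "r \<in> {1..n}")
    case True
    have "[1..<Suc n] = [1..<Suc r] @ [Suc r..<Suc n]"
      using True upt_add_eq_append[of 1 "Suc r" "n - r"] by simp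
    then have "rows_boxes n [1..<Suc n] = rows_boxes n [1..<Suc r] @ rows_boxes n [Suc r..<Suc n]"
      by (simp add: rows_boxes_def)
    moreover have "read_boxes P (rows_boxes n [Suc r..<Suc n]) x r = x r" for x
      by (rule read_boxes_other) (auto simp: set_rows_boxes box_pos_def)
    ultimately show ?thesis
      using trace_rows_match[of r n P] True
      by (auto simp: pd_perm_def trace_matches_def split: prod.splits)
  next
    case False
    have "read_boxes P (rows_boxes n [1..<Suc n]) (\<lambda>k. k) r = r"
      using False by (intro read_boxes_other) (auto simp: set_rows_boxes box_pos_def)
    then show ?thesis using False unfolding pd_perm_def by presburger
  qed
qed

lemma distinct_rows_boxes: "distinct rows \<Longrightarrow> distinct (rows_boxes n rows)"
  by (induction rows) (auto simp: rows_boxes_def row_boxes_def distinct_map inj_on_def)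

section \<open>Adding a cross\<close>

theorem theorem1p3:
  fixes n a :: nat and w :: "nat \<Rightarrow> nat" and P :: diagram
  assumes "w permutes {1..n}"
    and "fireworks n w"
    and "P \<in> PD n w"
    and "wt P < wt (upward_closure n n (rothe_diagram n w))"
    and "a \<in> {1..n}"
    and "wt P a < wt (upward_closure n n (rothe_diagram n w)) a"
  shows "\<exists>Q \<in> PD n w.
           (\<forall>b \<in> {1..n}. b < a \<longrightarrow> wt Q b = wt P b) \<and>
           wt Q a = wt P a + 1 \<and>
           (\<forall>b \<in> {1..n}. a < b \<longrightarrow> wt Q b \<le> wt P b)"
proof -
  have a: "1 \<le> a" "a \<le> n" using assms(5) by auto
  have P: "P \<subseteq> {(i, j). 1 \<le> i \<and> 1 \<le> j \<and> i + j \<le> n}"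
    and Pw: "read_boxes P (rows_boxes n [1..<Suc n]) (\<lambda>k. k) = w"
    using assms(3) by (auto simp: PD_def pipe_dreams_def pd_perm_eq)
  \<comment> \<open>The boxes above, in and below row \<open>a\<close>.\<close>
  define us where "us = rows_boxes n [1..<a]"
  define rs where "rs = row_boxes n a"
  define ls where "ls = rows_boxes n [Suc a..<Suc n]"
  have "[1..<Suc n] = [1..<a] @ [a] @ [Suc a..<Suc n]"
    using a upt_add_eq_append[of 1 a "Suc n - a"] by (simp add: upt_conv_Cons)
  then have boxes: "rows_boxes n [1..<Suc n] = us @ rs @ ls"
    by (simp add: us_def rs_def ls_def rows_boxes_def)
  have set_us: "set us = {(i, j). 1 \<le> i \<and> i < a \<and> 1 \<le> j \<and> j < n + 1 - i}"
    and set_ls: "set ls = {(i, j). a < i \<and> i \<le> n \<and> 1 \<le> j \<and> j < n + 1 - i}"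
    and set_rs: "set rs = {(i, j). i = a \<and> 1 \<le> j \<and> j < n + 1 - a}"
    by (auto simp: us_def ls_def rs_def set_rows_boxes row_boxes_def)
  have dist: "distinct (rs @ ls)"
    using distinct_rows_boxes[of "[1..<Suc n]" n] unfolding boxes by simp
  define v where "v = read_boxes P us (\<lambda>k. k)"
  have "bij v" unfolding v_def by (intro bij_read_boxes) (simp add: bij_id[unfolded id_def])
  have vw: "read_boxes P (rs @ ls) v = w" using Pw unfolding boxes by (simp add: v_def)
  have "bij w" using assms(1) by (rule permutes_bij)
  define S where "S = cross_positions P a"
  have wt_S: "wt P a = card (S \<inter> {a..<n})"
  proof -
    have "S \<inter> {a..<n} = (\<lambda>j. a + j - 1) ` {j. (a, j) \<in> P}"
    proof (intro equalityI subsetI)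
      fix k
      assume "k \<in> (\<lambda>j. a + j - 1) ` {j. (a, j) \<in> P}"
      then obtain j where "k = a + j - 1" "(a, j) \<in> P" "1 \<le> j" "a + j \<le> n" using P by auto
      then show "k \<in> S \<inter> {a..<n}"
        using cross_positions_iff[of a j P] a by (auto simp: S_def)
    qed (auto simp: S_def cross_positions_def box_pos_def)
    moreover have "inj_on (\<lambda>j. a + j - 1) {j. (a, j) \<in> P}"
      using P a by (fastforce intro: inj_onI)
    ultimately show ?thesis by (simp add: wt_def card_image)
  qed
  have row_w: "inversions (read_boxes P rs v) \<subseteq> inversions w"
    unfolding vw[symmetric] fold_append comp_apply by (rule inversions_read_boxes_mono)
  have "\<exists>d \<in> {a..<n} - S. \<forall>k \<in> {a..<n} \<inter> insert d S.
      v k < carried (insert d S) v n (Suc k) \<longrightarrow>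
      (carried (insert d S) v n (Suc k), v k) \<in> inversions w"
  proof (rule insertable_position[OF \<open>bij w\<close>])
    show "a \<le> n" by (fact a)
    show "inversions v \<subseteq> inversions w" using row_w inversions_read_boxes_mono by blast
    show "(carried S v n (Suc k), v k) \<in> inversions w"
      if "a \<le> k" "k < n" "k \<in> S" "v k < carried S v n (Suc k)" for k
      using that row_w unfolding rs_def inversions_read_row[OF a] S_def by blast
    show "card (S \<inter> {a..<n}) < card {i \<in> {a..<n}. w (Suc i) < w i}"
      using assms(6) wt_closure_le_descents[OF assms(1,2) a(1)] wt_S by simp
    \<comment> \<open>Row \<open>a\<close> and the rows below it only permute the positions from \<open>a\<close> to \<open>n\<close>.\<close>
    show "a \<le> inv w (v k) \<and> inv w (v k) \<le> n" if "a \<le> k" "k \<le> n" for k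
    proof (rule ccontr)
      assume *: "\<not> ?thesis"
      have "read_boxes P (rs @ ls) v (inv w (v k)) = v (inv w (v k))"
        using * a by (intro read_boxes_other) (auto simp: set_rs set_ls box_pos_def)
      then have "v k = v (inv w (v k))"
        using \<open>bij w\<close> by (simp only: vw) (simp add: bij_is_surj surj_f_inv_f)
      then have "inv w (v k) = k" using \<open>bij v\<close> by (metis bij_is_inj inj_eq)
      then show False using * that by simp
    qed
  qed
  then obtain d where "d \<in> {a..<n} - S"
    and legal: "\<forall>k \<in> {a..<n} \<inter> insert d S. v k < carried (insert d S) v n (Suc k) \<longrightarrow>
      (carried (insert d S) v n (Suc k), v k) \<in> inversions w" ..
  then have d: "a \<le> d" "d < n" "d \<notin> S" by auto
  define j where "j = d + 1 - a"
  define A where "A = insert (a, j) P"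
  have j: "1 \<le> j" "a + j - 1 = d" "a + j \<le> n" using d by (auto simp: j_def)
  have A: "cross_positions A a = insert d S"
  proof -
    have "{b \<in> A. fst b = a \<and> 1 \<le> snd b} = insert (a, j) {b \<in> P. fst b = a \<and> 1 \<le> snd b}"
      using j by (auto simp: A_def)
    then show ?thesis using j by (simp add: cross_positions_def S_def box_pos_def)
  qed
  have "inversions (read_boxes A rs v) \<subseteq> inversions w"
    unfolding rs_def inversions_read_row[OF a] A
  proof (intro Un_least)
    show "inversions v \<subseteq> inversions w" using row_w inversions_read_boxes_mono by blast
    show "{(carried (insert d S) v n (Suc k), v k) | k. a \<le> k \<and> k < n \<and> k \<in> insert d S \<and>
        v k < carried (insert d S) v n (Suc k)} \<subseteq> inversions w"
    proof
      fix r
      assume "r \<in> {(carried (insert d S) v n (Suc k), v k) | k. a \<le> k \<and> k < n \<and>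
        k \<in> insert d S \<and> v k < carried (insert d S) v n (Suc k)}"
      then obtain k where "r = (carried (insert d S) v n (Suc k), v k)"
        "k \<in> {a..<n} \<inter> insert d S" "v k < carried (insert d S) v n (Suc k)" by auto
      then show "r \<in> inversions w" using legal by blast
    qed
  qed
  then have "\<exists>Q. (\<forall>b. b \<notin> set (rs @ ls) \<longrightarrow> (b \<in> Q \<longleftrightarrow> b \<in> P)) \<and>
           (\<forall>b \<in> set rs. b \<in> Q \<longleftrightarrow> b \<in> A) \<and> Q \<inter> set ls \<subseteq> P \<and>
           read_boxes Q (rs @ ls) v = w"
    using \<open>bij v\<close> dist vw by (intro force_crosses) (auto simp: A_def)
  then obtain Q where Q: "\<And>b. b \<notin> set (rs @ ls) \<Longrightarrow> (b \<in> Q \<longleftrightarrow> b \<in> P)"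
    "\<And>b. b \<in> set rs \<Longrightarrow> b \<in> Q \<longleftrightarrow> b \<in> A" "Q \<inter> set ls \<subseteq> P" "read_boxes Q (rs @ ls) v = w"
    by blast
  have "read_boxes Q us (\<lambda>k. k) = v"
    unfolding v_def using Q(1) by (intro read_boxes_cong) (auto simp: set_us set_rs set_ls)
  then have Qw: "read_boxes Q (rows_boxes n [1..<Suc n]) (\<lambda>k. k) = w"
    using Q(4) unfolding boxes by simp
  have sub: "Q \<subseteq> insert (a, j) P"
  proof
    fix b
    assume "b \<in> Q"
    then show "b \<in> insert (a, j) P"
      using Q(1)[of b] Q(2)[of b] Q(3) unfolding A_def
      by (cases "b \<in> set rs"; cases "b \<in> set ls") auto
  qed
  then have "Q \<in> PD n w"
    using P j a Qw by (auto simp: PD_def pipe_dreams_def pd_perm_eq)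
  moreover have "wt Q b = wt P b" if "b < a" for b
  proof -
    have "(b, l) \<in> Q \<longleftrightarrow> (b, l) \<in> P" for l
      using Q(1)[of "(b, l)"] that by (auto simp: set_rs set_ls)
    then show ?thesis by (simp add: wt_def)
  qed
  moreover have finite_row: "finite {l. (b, l) \<in> P}" for b
    by (rule finite_subset[of _ "{..n}"]) (use P in auto)
  moreover have "wt Q a = wt P a + 1"
  proof -
    have "(a, l) \<in> Q \<longleftrightarrow> (a, l) \<in> insert (a, j) P" for l
      using Q(2)[of "(a, l)"] P j sub by (auto simp: set_rs A_def)
    then have "{l. (a, l) \<in> Q} = insert j {l. (a, l) \<in> P}" by auto
    moreover have "(a, j) \<notin> P"
      using cross_positions_iff[of a j P] a j d by (auto simp: S_def)
    ultimately show ?thesis using finite_row by (simp add: wt_def)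
  qed
  moreover have "wt Q b \<le> wt P b" if "a < b" for b
    unfolding wt_def using sub that finite_row by (intro card_mono) auto
  ultimately show ?thesis by blast
qed

end
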